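(* For every $n\ge1$, the polynomial $$\mathcal{A}_n(q,t):=\sum_{\sigma\in\mathcal{S}_n(231)}q^{\operatorname{maj}(\sigma)}\,t^{\binom{n}{2}-\operatorname{imaj}(\sigma)}$$ is symmetric in $q$ and $t$, i.e. $\mathcal{A}_n(q,t)=\mathcal{A}_n(t,q)$.
   Context: $\mathcal{S}_n$ is the symmetric group on $\{1,\dots,n\}$; $\mathcal{S}_n(231)$ is the set of $\sigma\in\mathcal{S}_n$ with no $i<j<k$ satisfying $\sigma_k<\sigma_i<\sigma_j$. The descent set is $\operatorname{Des}(\sigma)=\{i : 1\le i<n,\ \sigma_i>\sigma_{i+1}\}$, $\operatorname{maj}(\sigma)=\sum_{i\in\operatorname{Des}(\sigma)}i$, and $\operatorname{imaj}(\sigma)=\operatorname{maj}(\sigma^{-1})$. *)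

theory Defs
  imports Complex_Main "HOL-Combinatorics.Permutations"
begin

text \<open>
  A permutation in \<open>S\<^sub>n\<close> is a function \<open>\<sigma> :: nat \<Rightarrow> nat\<close> with \<open>\<sigma> permutes {1..n}\<close>;
  it is the identity outside \<open>{1..n}\<close>, so \<open>inv \<sigma>\<close> is its group-theoretic inverse.
\<close>

definition avoiding_231 :: "nat \<Rightarrow> (nat \<Rightarrow> nat) set" where
  "avoiding_231 n = {\<sigma>. \<sigma> permutes {1..n} \<and>
     \<not> (\<exists>i j k. 1 \<le> i \<and> i < j \<and> j < k \<and> k \<le> n \<and> \<sigma> k < \<sigma> i \<and> \<sigma> i < \<sigma> j)}"

definition Des :: "nat \<Rightarrow> (nat \<Rightarrow> nat) \<Rightarrow> nat set" where
  "Des n \<sigma> = {i. 1 \<le> i \<and> i < n \<and> \<sigma> i > \<sigma> (i + 1)}"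

definition maj :: "nat \<Rightarrow> (nat \<Rightarrow> nat) \<Rightarrow> nat" where
  "maj n \<sigma> = (\<Sum>i\<in>Des n \<sigma>. i)"

definition imaj :: "nat \<Rightarrow> (nat \<Rightarrow> nat) \<Rightarrow> nat" where
  "imaj n \<sigma> = maj n (inv \<sigma>)"

text \<open>The following bound shows that the subtraction in the exponent of \<open>t\<close> below never truncates.\<close>

lemma maj_le: "maj n \<sigma> \<le> n choose 2"
proof -
  have "maj n \<sigma> \<le> (\<Sum>i\<in>{0..<n}. i)"
    unfolding maj_def by (rule sum_mono2) (auto simp: Des_def)
  also have "\<dots> = n choose 2"
    by (simp add: Sum_Ico_nat choose_two)
  finally show ?thesis .
qed

lemma imaj_le: "imaj n \<sigma> \<le> n choose 2"
  by (simp add: imaj_def maj_le)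

text \<open>
  The polynomial with natural number coefficients is given by its value at elements \<open>q\<close>, \<open>t\<close>
  of an arbitrary commutative semiring. Taking two indeterminates for \<open>q\<close> and \<open>t\<close>, e.g.
  \<open>[:[:0, 1:]:]\<close> and \<open>[:0, 1:]\<close> of type \<open>int poly poly\<close>, gives the formal polynomial itself,
  so an identity for all \<open>q\<close>, \<open>t\<close> in all such semirings is an identity of polynomials.
\<close>

definition A_poly :: "nat \<Rightarrow> 'a::comm_semiring_1 \<Rightarrow> 'a \<Rightarrow> 'a" where
  "A_poly n q t = (\<Sum>\<sigma>\<in>avoiding_231 n. q ^ maj n \<sigma> * t ^ ((n choose 2) - imaj n \<sigma>))"

end

theory Submission
  imports Defs
begin

text \<open>
  A 231-avoiding permutation \<open>\<sigma>\<close> of \<open>{1..n}\<close> is encoded by the pair \<open>(A, B)\<close> of descent sets of \<open>\<sigma>\<close>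
  and of its inverse. The pairs that occur are exactly the pairs of equinumerous subsets of
  \<open>{1..<n}\<close> with \<open>A\<close> componentwise below \<open>B\<close>, and each of them occurs once
  (\<open>bij_betw_descent_sets\<close>). Complementation in \<open>{1..<n}\<close> reverses the componentwise order, so
  \<open>(A, B) \<mapsto> ({1..<n} - B, {1..<n} - A)\<close> is an involution on these pairs. It replaces the element
  sum of \<open>A\<close>, which is the exponent of \<open>q\<close>, by \<open>n choose 2\<close> minus the element sum of \<open>B\<close>, which
  is the exponent of \<open>t\<close>, and conversely. This is the asserted symmetry.

  The encoding rests on two observations. First, \<open>i\<close> is a descent of \<open>\<sigma>\<close> if and only if
  \<open>\<sigma> i - 1\<close> is a descent of the inverse (\<open>descent_iff_inverse_descent\<close>). Second, if \<open>\<sigma>\<close> does not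
  map \<open>{1..s}\<close> to itself, then every \<open>i \<le> s\<close> with \<open>\<sigma> i > s\<close> is a descent, because some later
  value is at most \<open>s\<close>. Comparing these \<open>i\<close> with the equally many \<open>i > s\<close> with
  \<open>\<sigma> i \<le> s\<close>, of which the last is no descent, gives \<open>|B \<inter> {..<s}| < |A \<inter> {..s}|\<close>, while equality
  holds if \<open>\<sigma>\<close> maps \<open>{1..s}\<close> to itself (\<open>card_Des_crossing\<close>, \<open>card_Des_no_crossing\<close>). The componentwise
  comparison follows.

  Injectivity compares two permutations from right to left. Surjectivity is by induction on \<open>n\<close>:
  deleting the largest value \<open>n\<close> from the word of a permutation leaves a permutation that
  maps \<open>{1..s}\<close> to itself, where \<open>s\<close> is the number of letters before \<open>n\<close>, and by the criterion
  above this \<open>s\<close> can be read off from the pair \<open>(A, B)\<close>.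
\<close>

section \<open>Descents of a permutation and of its inverse\<close>

lemma avoiding_231D:
  assumes "\<sigma> \<in> avoiding_231 n" "1 \<le> i" "i < j" "j < k" "k \<le> n" "\<sigma> i < \<sigma> j"
  shows "\<sigma> i < \<sigma> k"
proof -
  have p: "\<sigma> permutes {1..n}" and "\<not> \<sigma> k < \<sigma> i"
    using assms unfolding avoiding_231_def by blast+
  moreover have "\<sigma> k \<noteq> \<sigma> i"
    using permutes_inj[OF p] assms by (metis inj_eq less_trans nat_neq_iff)
  ultimately show ?thesis by simp
qed

lemma permutes_in_range:
  fixes n :: nat
  assumes "\<sigma> permutes {1..n}" "1 \<le> i" "i \<le> n"
  shows "1 \<le> \<sigma> i" "\<sigma> i \<le> n"
  using permutes_in_image[OF assms(1), of i] assms(2,3) by auto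

lemma finite_Des [simp]: "finite (Des n \<sigma>)"
  unfolding Des_def by simp

lemma Des_subset: "Des n \<sigma> \<subseteq> {1..<n}"
  unfolding Des_def by auto

text \<open>A position that is not a descent carries a value smaller than all later ones: otherwise that
  value, its right neighbour and a smaller later value form the pattern 231.\<close>

lemma non_descents_increasing:
  assumes av: "\<sigma> \<in> avoiding_231 n" and "1 \<le> i" "i < j" "j \<le> n" "i \<notin> Des n \<sigma>"
  shows "\<sigma> i < \<sigma> j"
proof -
  have p: "\<sigma> permutes {1..n}" using av by (simp add: avoiding_231_def)
  have "\<sigma> i \<noteq> \<sigma> (i+1)" using permutes_inj[OF p] by (metis inj_eq n_not_Suc_n Suc_eq_plus1)
  then have 1: "\<sigma> i < \<sigma> (i+1)" using assms(2-5) by (auto simp: Des_def)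
  show ?thesis
  proof (cases "j = i + 1")
    case False
    then show ?thesis using avoiding_231D[OF av, of i "i+1" j] 1 assms(2-4) by auto
  qed (use 1 in simp)
qed

text \<open>For \<open>\<sigma> i = 1\<close> the truncated difference \<open>\<sigma> i - 1\<close> is \<open>0\<close>, which is never a descent, and
  \<open>i\<close> is not a descent either.\<close>

lemma descent_iff_inverse_descent:
  assumes av: "\<sigma> \<in> avoiding_231 n" and i: "1 \<le> i" "i \<le> n"
  shows "i \<in> Des n \<sigma> \<longleftrightarrow> \<sigma> i - 1 \<in> Des n (inv \<sigma>)"
proof -
  have p: "\<sigma> permutes {1..n}" using av by (simp add: avoiding_231_def)
  note inv = permutes_inverses[OF p]
  note range = permutes_in_range[OF p]
  show ?thesis
  proof
    assume "i \<in> Des n \<sigma>"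
    then have d: "i < n" "\<sigma> (i+1) < \<sigma> i" by (auto simp: Des_def)
    define v where "v = \<sigma> i - 1"
    define j where "j = inv \<sigma> v"
    have v: "\<sigma> i = v + 1" "1 \<le> v" "v < n"
      using d range[of i] range[of "i+1"] i unfolding v_def by auto
    have j: "\<sigma> j = v" "1 \<le> j" "j \<le> n"
      using permutes_in_range[OF permutes_inv[OF p], of v] v inv unfolding j_def by auto
    have "i < j"
    proof (rule ccontr)
      assume "\<not> i < j"
      then have "j < i" using j(1) v(1) by (metis linorder_neqE_nat n_not_Suc_n Suc_eq_plus1)
      \<comment> \<open>the values \<open>v\<close>, \<open>v + 1\<close>, \<open>\<sigma> (i+1)\<close> would form the pattern 231\<close>
      from avoiding_231D[OF av j(2) this, of "i+1"] show False using d v j by auto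
    qed
    moreover have "inv \<sigma> (v+1) = i" using v(1) inv by metis
    ultimately show "\<sigma> i - 1 \<in> Des n (inv \<sigma>)"
      using v unfolding v_def[symmetric] by (auto simp: Des_def j_def)
  next
    assume *: "\<sigma> i - 1 \<in> Des n (inv \<sigma>)"
    define j where "j = inv \<sigma> (\<sigma> i - 1)"
    have v: "1 \<le> \<sigma> i - 1" "\<sigma> i - 1 < n" using * by (auto simp: Des_def)
    then have "Suc (\<sigma> i - 1) = \<sigma> i" by simp
    then have "i < j" using * inv by (auto simp: Des_def j_def)
    moreover have "\<sigma> j < \<sigma> i" "j \<le> n"
      using permutes_in_range[OF permutes_inv[OF p], of "\<sigma> i - 1"] v inv unfolding j_def by auto
    ultimately show "i \<in> Des n \<sigma>"
      using non_descents_increasing[OF av i(1)] by (meson not_less_iff_gr_or_eq)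
  qed
qed

lemma Des_inv_eq_image:
  assumes av: "\<sigma> \<in> avoiding_231 n"
  shows "Des n (inv \<sigma>) = (\<lambda>i. \<sigma> i - 1) ` Des n \<sigma>"
proof
  have p: "\<sigma> permutes {1..n}" using av by (simp add: avoiding_231_def)
  show "(\<lambda>i. \<sigma> i - 1) ` Des n \<sigma> \<subseteq> Des n (inv \<sigma>)"
    using descent_iff_inverse_descent[OF av] Des_subset[of n \<sigma>] by force
  show "Des n (inv \<sigma>) \<subseteq> (\<lambda>i. \<sigma> i - 1) ` Des n \<sigma>"
  proof
    fix v assume v: "v \<in> Des n (inv \<sigma>)"
    then have "1 \<le> v+1" "v+1 \<le> n" by (auto simp: Des_def)
    note r = permutes_in_range[OF permutes_inv[OF p] this]
    have e: "v = \<sigma> (inv \<sigma> (v+1)) - 1" using permutes_inverses[OF p] by simp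
    moreover have "inv \<sigma> (v+1) \<in> Des n \<sigma>"
      using descent_iff_inverse_descent[OF av r] v e by simp
    ultimately show "v \<in> (\<lambda>i. \<sigma> i - 1) ` Des n \<sigma>" by blast
  qed
qed

lemma card_Des_inv_below:
  assumes av: "\<sigma> \<in> avoiding_231 n"
  shows "card (Des n (inv \<sigma>) \<inter> {..<s}) = card {i \<in> Des n \<sigma>. \<sigma> i \<le> s}"
proof -
  have p: "\<sigma> permutes {1..n}" using av by (simp add: avoiding_231_def)
  have ge: "2 \<le> \<sigma> i" if "i \<in> Des n \<sigma>" for i
    using that permutes_in_range[OF p, of "i+1"] by (auto simp: Des_def)
  have "Des n (inv \<sigma>) \<inter> {..<s} = (\<lambda>i. \<sigma> i - 1) ` {i \<in> Des n \<sigma>. \<sigma> i \<le> s}"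
    unfolding Des_inv_eq_image[OF av] using ge by force
  moreover have "inj_on (\<lambda>i. \<sigma> i - 1) {i \<in> Des n \<sigma>. \<sigma> i \<le> s}"
  proof (rule inj_onI)
    fix i j assume "i \<in> {i \<in> Des n \<sigma>. \<sigma> i \<le> s}" "j \<in> {i \<in> Des n \<sigma>. \<sigma> i \<le> s}" "\<sigma> i - 1 = \<sigma> j - 1"
    then have "\<sigma> i = \<sigma> j" using ge[of i] ge[of j] by auto
    then show "i = j" using permutes_inj[OF p] by (simp add: inj_eq)
  qed
  ultimately show ?thesis by (simp add: card_image)
qed

lemma inj_on_descent_sets:
  "inj_on (\<lambda>\<sigma>. (Des n \<sigma>, Des n (inv \<sigma>))) (avoiding_231 n)"
proof (rule inj_onI)
  fix \<sigma> \<tau>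
  assume av: "\<sigma> \<in> avoiding_231 n" "\<tau> \<in> avoiding_231 n"
    and eq: "(Des n \<sigma>, Des n (inv \<sigma>)) = (Des n \<tau>, Des n (inv \<tau>))"
  \<comment> \<open>two permutations that agree to the right of \<open>i\<close> also agree at \<open>i\<close>; by symmetry, it suffices to
    exclude \<open>\<sigma> i < \<tau> i\<close>\<close>
  have step: False
    if av: "\<sigma> \<in> avoiding_231 n" "\<tau> \<in> avoiding_231 n"
      and D: "Des n \<sigma> = Des n \<tau>" "Des n (inv \<sigma>) = Des n (inv \<tau>)"
      and i: "1 \<le> i" "i \<le> n" and agree: "\<And>j. i < j \<Longrightarrow> \<sigma> j = \<tau> j" and lt: "\<sigma> i < \<tau> i"
    for \<sigma> \<tau> i
  proof -
    have p: "\<sigma> permutes {1..n}" "\<tau> permutes {1..n}" using av by (auto simp: avoiding_231_def)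
    have inj: "inj \<sigma>" "inj \<tau>" using p permutes_inj by blast+
    show False
    proof (cases "i \<in> Des n \<sigma>")
      case True
      \<comment> \<open>in \<open>\<tau>\<close> the value \<open>\<sigma> i\<close> occurs left of \<open>i\<close> and forms 231 with \<open>\<tau> i\<close> and \<open>\<tau> (i+1)\<close>\<close>
      define j where "j = inv \<tau> (\<sigma> i)"
      have j: "\<tau> j = \<sigma> i" "1 \<le> j" "j \<le> n"
        using permutes_in_range[OF p(1) i] permutes_in_range[OF permutes_inv[OF p(2)], of "\<sigma> i"]
          permutes_inverses[OF p(2)] unfolding j_def by auto
      have "\<not> i < j" using agree[of j] j inj by (metis inj_eq nat_less_le)
      moreover have "i \<noteq> j" using lt j by auto
      ultimately have "j < i" by simp
      from avoiding_231D[OF av(2) j(2) this, of "i+1"] show False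
        using True lt j agree[of "i+1"] by (auto simp: Des_def)
    next
      case False
      \<comment> \<open>in \<open>\<sigma>\<close> the value \<open>\<tau> i\<close> occurs left of \<open>i\<close>; its position there is no descent, since
        whether it is one depends only on the value and the inverse descent set\<close>
      define j where "j = inv \<sigma> (\<tau> i)"
      have j: "\<sigma> j = \<tau> i" "1 \<le> j" "j \<le> n"
        using permutes_in_range[OF p(2) i] permutes_in_range[OF permutes_inv[OF p(1)], of "\<tau> i"]
          permutes_inverses[OF p(1)] unfolding j_def by auto
      have "\<not> i < j" using agree[of j] j inj by (metis inj_eq nat_less_le)
      moreover have "i \<noteq> j" using lt j by auto
      ultimately have "j < i" by simp
      moreover have "j \<notin> Des n \<sigma>"
        using descent_iff_inverse_descent[OF av(1) j(2,3)] descent_iff_inverse_descent[OF av(2) i]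
          False D j(1) by simp
      ultimately have "\<sigma> j < \<sigma> i" using non_descents_increasing[OF av(1) j(2)] i by auto
      then show False using j lt by simp
    qed
  qed
  have "\<sigma> i = \<tau> i" for i
  proof (induction "n - i" arbitrary: i rule: less_induct)
    case less
    have outside: "\<sigma> j = \<tau> j" if "j \<notin> {1..n}" for j
      using that av by (auto simp: avoiding_231_def permutes_def)
    show ?case
    proof (cases "i \<in> {1..n}")
      case True
      have "\<sigma> j = \<tau> j" if "i < j" for j
        using less[of j] outside[of j] that True by (cases "j \<le> n") auto
      with step[OF av _ _, of i] step[OF av(2,1) _ _, of i] eq True
      show ?thesis by (metis Pair_inject atLeastAtMost_iff linorder_neqE_nat)
    qed (use outside in simp)
  qed
  then show "\<sigma> = \<tau>" by blast
qed

section \<open>Dominance of the descent sets\<close>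

lemma card_up_crossings_eq_down_crossings:
  fixes n s :: nat
  assumes p: "\<sigma> permutes {1..n}" and "s \<le> n"
  shows "card {i. 1 \<le> i \<and> i \<le> s \<and> s < \<sigma> i} = card {i. s < i \<and> i \<le> n \<and> \<sigma> i \<le> s}"
    (is "card ?U = card ?L")
proof -
  let ?C = "{i. 1 \<le> i \<and> i \<le> s \<and> \<sigma> i \<le> s}"
  have fin: "finite ?U" "finite ?L" "finite ?C"
    by (rule finite_subset[of _ "{..n}"]; use assms in force)+
  have "?C \<union> ?U = {1..s}" "?C \<inter> ?U = {}" by auto
  then have 1: "card ?C + card ?U = s"
    using card_Un_disjoint[OF fin(3,1)] by simp
  have "?C \<union> ?L = inv \<sigma> ` {1..s}"
  proof
    show "?C \<union> ?L \<subseteq> inv \<sigma> ` {1..s}"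
    proof
      fix i assume "i \<in> ?C \<union> ?L"
      then have "1 \<le> i" "i \<le> n" "\<sigma> i \<le> s" using assms by auto
      moreover have "inv \<sigma> (\<sigma> i) = i" using permutes_inverses[OF p] by simp
      ultimately show "i \<in> inv \<sigma> ` {1..s}" using permutes_in_range[OF p, of i]
        by (metis atLeastAtMost_iff image_eqI)
    qed
    show "inv \<sigma> ` {1..s} \<subseteq> ?C \<union> ?L"
      using permutes_in_range[OF permutes_inv[OF p]] permutes_inverses[OF p] assms by fastforce
  qed
  moreover have "card (inv \<sigma> ` {1..s}) = s"
    using card_image[OF inj_on_subset[OF permutes_inj[OF permutes_inv[OF p]] subset_UNIV], of "{1..s}"]
    by simp
  moreover have "?C \<inter> ?L = {}" by auto
  ultimately have "card ?C + card ?L = s"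
    using card_Un_disjoint[OF fin(3,2)] by simp
  then show ?thesis using 1 by simp
qed

lemma split_right:
  fixes n s :: nat
  assumes p: "\<sigma> permutes {1..n}" and "s \<le> n"
    and split: "\<And>i. 1 \<le> i \<Longrightarrow> i \<le> s \<Longrightarrow> \<sigma> i \<le> s" and i: "s < i" "i \<le> n"
  shows "s < \<sigma> i"
proof (rule ccontr)
  assume "\<not> s < \<sigma> i"
  then have "i \<in> {i. s < i \<and> i \<le> n \<and> \<sigma> i \<le> s}" (is "_ \<in> ?L") using i by simp
  moreover have "finite ?L" by (auto intro: finite_subset[of _ "{..n}"])
  ultimately have "card ?L \<noteq> 0" by auto
  moreover have "{i. 1 \<le> i \<and> i \<le> s \<and> s < \<sigma> i} = {}" using split by force
  ultimately show False
    using card_up_crossings_eq_down_crossings[OF p \<open>s \<le> n\<close>] by (metis card.empty)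
qed

text \<open>The hypothesis on \<open>i\<close> says that \<open>\<sigma>\<close> does not map \<open>{1..s}\<close> to itself. Both sides count the descents
  \<open>j \<le> s\<close> with \<open>\<sigma> j \<le> s\<close>, the set \<open>C\<close> below. In addition, the right side counts all of \<open>U\<close>, and
  the left side, rewritten by \<open>card_Des_inv_below\<close>, counts the descents in \<open>L\<close>. These form a
  proper subset of \<open>L\<close>, and \<open>L\<close> and \<open>U\<close> are equinumerous.\<close>

lemma card_Des_crossing:
  assumes av: "\<sigma> \<in> avoiding_231 n" and s: "s \<le> n" and i: "1 \<le> i" "i \<le> s" "s < \<sigma> i"
  shows "card (Des n (inv \<sigma>) \<inter> {..<s}) < card (Des n \<sigma> \<inter> {..s})"
proof -
  have p: "\<sigma> permutes {1..n}" using av by (simp add: avoiding_231_def)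
  define U where "U = {i. 1 \<le> i \<and> i \<le> s \<and> s < \<sigma> i}"
  define L where "L = {i. s < i \<and> i \<le> n \<and> \<sigma> i \<le> s}"
  define C where "C = {i \<in> Des n \<sigma>. i \<le> s \<and> \<sigma> i \<le> s}"
  define K where "K = {i \<in> Des n \<sigma>. s < i \<and> \<sigma> i \<le> s}"
  have fin: "finite U" "finite L" "finite C" "finite K"
    unfolding U_def L_def C_def K_def by (auto intro: finite_subset[of _ "{..n}"])
  have UL: "card U = card L"
    unfolding U_def L_def by (rule card_up_crossings_eq_down_crossings[OF p s])
  have "U \<noteq> {}" using i by (auto simp: U_def)
  then have "L \<noteq> {}" using UL fin by auto
  define l where "l = Max L"
  have l: "l \<in> L" using Max_in[OF fin(2) \<open>L \<noteq> {}\<close>] by (simp add: l_def)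
  have "U \<subseteq> Des n \<sigma>"
  proof
    fix j assume "j \<in> U"
    then show "j \<in> Des n \<sigma>"
      using non_descents_increasing[OF av, of j l] l by (auto simp: U_def L_def)
  qed
  then have "Des n \<sigma> \<inter> {..s} = C \<union> U"
    by (auto simp: C_def U_def Des_def)
  moreover have "C \<inter> U = {}" by (auto simp: C_def U_def)
  ultimately have 1: "card (Des n \<sigma> \<inter> {..s}) = card C + card U"
    using fin by (simp add: card_Un_disjoint)
  have "{i \<in> Des n \<sigma>. \<sigma> i \<le> s} = C \<union> K" "C \<inter> K = {}" by (auto simp: C_def K_def)
  then have 2: "card {i \<in> Des n \<sigma>. \<sigma> i \<le> s} = card C + card K"
    using fin by (simp add: card_Un_disjoint)
  have "K \<subseteq> L" by (auto simp: K_def L_def Des_def)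
  \<comment> \<open>the letter after the last position in \<open>L\<close>, if any, is larger than \<open>s\<close>\<close>
  moreover have "l \<notin> K"
  proof
    assume "l \<in> K"
    then have "l + 1 \<in> L" by (auto simp: K_def L_def Des_def)
    then show False using Max_ge[OF fin(2), of "l+1"] by (simp add: l_def)
  qed
  ultimately have "card K < card L" using l fin by (intro psubset_card_mono) auto
  then show ?thesis using 1 2 UL card_Des_inv_below[OF av, of s] by simp
qed

lemma card_Des_no_crossing:
  assumes av: "\<sigma> \<in> avoiding_231 n" and s: "s \<le> n" and split: "\<And>i. 1 \<le> i \<Longrightarrow> i \<le> s \<Longrightarrow> \<sigma> i \<le> s"
  shows "card (Des n (inv \<sigma>) \<inter> {..<s}) = card (Des n \<sigma> \<inter> {..s})" "s \<notin> Des n \<sigma>"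
proof -
  have p: "\<sigma> permutes {1..n}" using av by (simp add: avoiding_231_def)
  note right = split_right[OF p s split]
  have "{i \<in> Des n \<sigma>. \<sigma> i \<le> s} = Des n \<sigma> \<inter> {..s}"
  proof (intro equalityI subsetI)
    fix i assume "i \<in> {i \<in> Des n \<sigma>. \<sigma> i \<le> s}"
    then show "i \<in> Des n \<sigma> \<inter> {..s}" using right[of i] by (force simp: Des_def not_less)
  next
    fix i assume "i \<in> Des n \<sigma> \<inter> {..s}"
    then show "i \<in> {i \<in> Des n \<sigma>. \<sigma> i \<le> s}" using split[of i] by (simp add: Des_def)
  qed
  then show "card (Des n (inv \<sigma>) \<inter> {..<s}) = card (Des n \<sigma> \<inter> {..s})"
    using card_Des_inv_below[OF av, of s] by simp
  show "s \<notin> Des n \<sigma>"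
    using split[of s] right[of "s+1"] by (auto simp: Des_def)
qed

text \<open>
  Pairs of equinumerous subsets of \<open>{1..<n}\<close> such that the \<open>r\<close>-th smallest element of the first is
  at most the \<open>r\<close>-th smallest element of the second, for every \<open>r\<close>. This componentwise order is
  expressed by counting initial segments, which makes it manifestly antitone under complements.
\<close>

definition dominating_pairs :: "nat \<Rightarrow> (nat set \<times> nat set) set" where
  "dominating_pairs n = {(A, B). A \<subseteq> {1..<n} \<and> B \<subseteq> {1..<n} \<and> card A = card B \<and>
     (\<forall>m. card (B \<inter> {..m}) \<le> card (A \<inter> {..m}))}"

lemma card_Int_atMost_Suc:
  fixes A :: "nat set"
  shows "card (A \<inter> {..Suc m}) = card (A \<inter> {..m}) + (if Suc m \<in> A then 1 else 0)"
proof -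
  have "A \<inter> {..Suc m} = (if Suc m \<in> A then insert (Suc m) (A \<inter> {..m}) else A \<inter> {..m})"
    by (auto simp: le_Suc_eq)
  then show ?thesis by simp
qed

lemma descent_sets_dominating:
  assumes av: "\<sigma> \<in> avoiding_231 n"
  shows "(Des n \<sigma>, Des n (inv \<sigma>)) \<in> dominating_pairs n"
proof -
  have p: "\<sigma> permutes {1..n}" using av by (simp add: avoiding_231_def)
  have "Des n (inv \<sigma>) \<inter> {..<n} = Des n (inv \<sigma>)" "Des n \<sigma> \<inter> {..n} = Des n \<sigma>"
    by (auto simp: Des_def)
  then have card: "card (Des n \<sigma>) = card (Des n (inv \<sigma>))"
    using card_Des_no_crossing(1)[OF av order_refl] permutes_in_range[OF p] by auto
  have "card (Des n (inv \<sigma>) \<inter> {..m}) \<le> card (Des n \<sigma> \<inter> {..m})" for m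
  proof (cases "Suc m \<le> n")
    case True
    show ?thesis
    proof (cases "\<exists>i. 1 \<le> i \<and> i \<le> Suc m \<and> Suc m < \<sigma> i")
      case c: True
      then have "card (Des n (inv \<sigma>) \<inter> {..m}) < card (Des n \<sigma> \<inter> {..Suc m})"
        using card_Des_crossing[OF av True] by (auto simp: lessThan_Suc_atMost)
      then show ?thesis
        using card_Int_atMost_Suc[of "Des n \<sigma>" m] by (simp split: if_splits)
    next
      case False
      then have "\<And>i. 1 \<le> i \<Longrightarrow> i \<le> Suc m \<Longrightarrow> \<sigma> i \<le> Suc m" by (meson not_le)
      from card_Des_no_crossing[OF av True this] show ?thesis
        using card_Int_atMost_Suc[of "Des n \<sigma>" m] by (simp add: lessThan_Suc_atMost)
    qed
  next
    case False
    then have "Des n (inv \<sigma>) \<inter> {..m} = Des n (inv \<sigma>)" "Des n \<sigma> \<inter> {..m} = Des n \<sigma>"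
      by (auto simp: Des_def)
    then show ?thesis using card by simp
  qed
  then show ?thesis using card Des_subset[of n \<sigma>] Des_subset[of n "inv \<sigma>"]
    by (simp add: dominating_pairs_def)
qed

section \<open>Every dominating pair comes from a permutation\<close>

text \<open>The one-line word of \<open>\<tau>\<close>, a permutation of \<open>{1..N}\<close>, with the new maximum \<open>N + 1\<close> inserted
  right after its first \<open>s\<close> letters.\<close>

definition insert_max :: "nat \<Rightarrow> nat \<Rightarrow> (nat \<Rightarrow> nat) \<Rightarrow> nat \<Rightarrow> nat" where
  "insert_max N s \<tau> i = (if i \<le> s then \<tau> i else if i = Suc s then Suc N
     else if i \<le> Suc N then \<tau> (i - 1) else i)"

lemma insert_max_permutes:
  assumes p: "\<tau> permutes {1..N}" and s: "s \<le> N"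
  shows "insert_max N s \<tau> permutes {1..Suc N}"
proof (rule bij_imp_permutes)
  let ?f = "insert_max N s \<tau>"
  note r = permutes_in_range[OF p]
  define g where "g i = (if i \<le> s then i else i - 1)" for i :: nat
  have f: "?f i = \<tau> (g i)" if "i \<noteq> Suc s" "i \<le> Suc N" for i
    using that by (auto simp: insert_max_def g_def)
  have old: "?f i \<le> N" if "1 \<le> i" "i \<le> Suc N" "i \<noteq> Suc s" for i
    using that s r(2)[of "g i"] f[of i] by (auto simp: g_def split: if_splits)
  have max: "?f (Suc s) = Suc N" by (simp add: insert_max_def)
  have inj: "inj_on ?f {1..Suc N}"
  proof (rule inj_onI)
    fix i j assume ij: "i \<in> {1..Suc N}" "j \<in> {1..Suc N}" "?f i = ?f j"
    show "i = j"
    proof (cases "i = Suc s \<or> j = Suc s")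
      case True
      then show ?thesis using ij old[of i] old[of j] max by fastforce
    next
      case False
      then have "\<tau> (g i) = \<tau> (g j)" using ij f by simp
      then have "g i = g j" using permutes_inj[OF p] by (simp add: inj_eq)
      then show ?thesis using False by (auto simp: g_def split: if_splits)
    qed
  qed
  have sub: "?f ` {1..Suc N} \<subseteq> {1..Suc N}"
  proof
    fix v assume "v \<in> ?f ` {1..Suc N}"
    then obtain i where i: "1 \<le> i" "i \<le> Suc N" "v = ?f i" by auto
    have "1 \<le> g i" "g i \<le> N" if "i \<noteq> Suc s"
      using that i s by (auto simp: g_def)
    then show "v \<in> {1..Suc N}"
      using i f[of i] r[of "g i"] max by (cases "i = Suc s") auto
  qed
  show "bij_betw ?f {1..Suc N} {1..Suc N}"
    using endo_inj_surj[OF _ sub inj] inj by (simp add: bij_betw_def)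
  show "?f x = x" if "x \<notin> {1..Suc N}" for x
    using that s permutes_not_in[OF p, of x] by (auto simp: insert_max_def)
qed

text \<open>The inserted maximum could only play the role of 3 in a pattern 231, but all values before it
  are smaller than all values after it.\<close>

lemma insert_max_avoiding:
  assumes av: "\<tau> \<in> avoiding_231 N" and s: "s \<le> N"
    and split: "\<And>i. 1 \<le> i \<Longrightarrow> i \<le> s \<Longrightarrow> \<tau> i \<le> s"
  shows "insert_max N s \<tau> \<in> avoiding_231 (Suc N)"
proof -
  let ?f = "insert_max N s \<tau>"
  have p: "\<tau> permutes {1..N}" using av by (simp add: avoiding_231_def)
  have pf: "?f permutes {1..Suc N}" by (rule insert_max_permutes[OF p s])
  note rf = permutes_in_range[OF pf]
  note right = split_right[OF p s split]
  have "\<not> (?f k < ?f i \<and> ?f i < ?f j)" if ijk: "1 \<le> i" "i < j" "j < k" "k \<le> Suc N" for i j k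
  proof
    assume pat: "?f k < ?f i \<and> ?f i < ?f j"
    have max: "?f (Suc s) = Suc N" by (simp add: insert_max_def)
    have ne: "i \<noteq> Suc s" "k \<noteq> Suc s"
      using pat max rf(2)[of i] rf(2)[of j] ijk by auto
    show False
    proof (cases "j = Suc s")
      case True
      then have "?f i = \<tau> i" "?f k = \<tau> (k-1)" using ijk by (auto simp: insert_max_def)
      moreover have "s < k - 1" "k - 1 \<le> N" "i \<le> s" using ijk True by auto
      ultimately show False using pat split[of i] right[of "k-1"] ijk(1) by simp
    next
      case False
      \<comment> \<open>deleting the maximum turns positions of \<open>?f\<close> into positions of \<open>\<tau>\<close>\<close>
      define g where "g i = (if i \<le> s then i else i - 1)" for i :: nat
      have f: "?f x = \<tau> (g x)" if "x \<noteq> Suc s" "x \<le> Suc N" for x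
        using that by (auto simp: insert_max_def g_def)
      have "1 \<le> g i" "g i < g j" "g j < g k" "g k \<le> N"
        using ijk ne False s by (auto simp: g_def)
      from avoiding_231D[OF av this] show False using pat f ijk ne False by auto
    qed
  qed
  then show ?thesis using pf unfolding avoiding_231_def by blast
qed

lemma dominating_pair_max:
  assumes d: "(A, B) \<in> dominating_pairs n" and a: "a \<in> A"
  shows "\<exists>b\<in>B. a \<le> b"
proof (rule ccontr)
  assume "\<not> ?thesis"
  then have b: "b < a" if "b \<in> B" for b using that by force
  have A: "finite A" "card A = card B" "A \<subseteq> {1..<n}"
    and dom: "\<And>m. card (B \<inter> {..m}) \<le> card (A \<inter> {..m})"
    using d finite_subset[of A "{1..<n}"] by (auto simp: dominating_pairs_def)
  have "B \<inter> {..a - 1} = B" using b by force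
  then have "card A \<le> card (A \<inter> {..a - 1})" using dom[of "a-1"] A by simp
  moreover have "A \<inter> {..a - 1} \<subset> A" using a A(3) by force
  ultimately show False using psubset_card_mono[OF A(1), of "A \<inter> {..a - 1}"] by simp
qed

text \<open>The number of letters before the maximum, recovered from the descent sets: the
  last \<open>s\<close> that satisfies the criterion for mapping \<open>{1..s}\<close> to itself. The maximum
  itself is the descent at \<open>Suc s\<close>.\<close>

lemma dominating_pair_obtain_split:
  assumes d: "(A, B) \<in> dominating_pairs (Suc N)" and N: "N \<in> B"
  obtains s where "s < N" "Suc s \<in> A" "s \<notin> A"
    "card (A \<inter> {..s}) \<le> card (B \<inter> {..<s})"
    "\<And>m. s < m \<Longrightarrow> m \<le> N \<Longrightarrow> card (B \<inter> {..<m}) < card (A \<inter> {..m})"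
proof -
  have A: "A \<subseteq> {1..<Suc N}" "B \<subseteq> {1..<Suc N}" "card A = card B"
    and dom: "\<And>m. card (B \<inter> {..m}) \<le> card (A \<inter> {..m})"
    using d by (auto simp: dominating_pairs_def)
  have finB: "finite B" using A(2) finite_subset by blast
  define Z where "Z = {m. m \<le> N \<and> card (A \<inter> {..m}) \<le> card (B \<inter> {..<m})}"
  have finZ: "finite Z" by (simp add: Z_def)
  have "A \<inter> {..0} = {}" using A by force
  then have "0 \<in> Z" by (simp add: Z_def)
  then have Z: "Z \<noteq> {}" by blast
  define s where "s = Max Z"
  have s: "s \<in> Z" using Max_in[OF finZ Z] by (simp add: s_def)
  have above: "card (B \<inter> {..<m}) < card (A \<inter> {..m})" if "s < m" "m \<le> N" for m
  proof -
    have "m \<notin> Z" using Max_ge[OF finZ, of m] that by (auto simp: s_def)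
    then show ?thesis using that by (simp add: Z_def)
  qed
  have "N \<notin> Z"
  proof
    assume "N \<in> Z"
    moreover have "A \<inter> {..N} = A" using A by force
    ultimately have "card B \<le> card (B \<inter> {..<N})" using A by (simp add: Z_def)
    moreover have "B \<inter> {..<N} \<subset> B" using N by force
    ultimately show False using psubset_card_mono[OF finB, of "B \<inter> {..<N}"] by simp
  qed
  then have sN: "s < N" using s by (metis (lifting) Z_def mem_Collect_eq nat_less_le)
  have le: "card (A \<inter> {..s}) \<le> card (B \<inter> {..<s})" using s by (simp add: Z_def)
  have "card (B \<inter> {..<s}) \<le> card (B \<inter> {..<Suc s})"
    using finB by (intro card_mono) auto
  then have S: "Suc s \<in> A"
    using above[of "Suc s"] le sN card_Int_atMost_Suc[of A s] by (auto split: if_splits)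
  have "s \<notin> A"
  proof
    assume "s \<in> A"
    then obtain m where m: "s = Suc m" using A(1) by (cases s) auto
    then show False
      using dom[of m] le card_Int_atMost_Suc[of A m] \<open>s \<in> A\<close> by (simp add: lessThan_Suc_atMost)
  qed
  then show ?thesis using that sN S le above by blast
qed

lemma Des_Suc_permutes:
  assumes "\<sigma> permutes {1..N}"
  shows "Des (Suc N) \<sigma> = Des N \<sigma>"
proof -
  have "N \<notin> Des (Suc N) \<sigma>"
    using permutes_not_in[OF assms, of "Suc N"] permutes_in_range[OF assms, of N]
    by (auto simp: Des_def)
  then show ?thesis by (auto simp: Des_def less_Suc_eq)
qed

lemma dominating_pair_realized:
  assumes "(A, B) \<in> dominating_pairs n"
  shows "\<exists>\<sigma> \<in> avoiding_231 n. Des n \<sigma> = A \<and> Des n (inv \<sigma>) = B"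
  using assms
proof (induction n arbitrary: A B)
  case 0
  then have "A = {}" "B = {}" by (auto simp: dominating_pairs_def)
  moreover have "id \<in> avoiding_231 0" by (simp add: avoiding_231_def permutes_id)
  ultimately show ?case by (auto simp: Des_def)
next
  case (Suc N)
  note d = Suc.prems
  have A: "A \<subseteq> {1..<Suc N}" "B \<subseteq> {1..<Suc N}" "card A = card B"
    and dom: "\<And>m. card (B \<inter> {..m}) \<le> card (A \<inter> {..m})"
    using d by (auto simp: dominating_pairs_def)
  have fin: "finite A" "finite B" using A finite_subset by blast+
  show ?case
  proof (cases "N \<in> B")
    case False
    then have B: "B \<subseteq> {1..<N}" using A(2) by (force simp: less_Suc_eq)
    have "N \<notin> A"
      using dominating_pair_max[OF d, of N] B by force
    then have "A \<subseteq> {1..<N}" using A(1) by (force simp: less_Suc_eq)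
    then have "(A, B) \<in> dominating_pairs N" using B A dom by (simp add: dominating_pairs_def)
    then obtain \<tau> where \<tau>: "\<tau> \<in> avoiding_231 N" "Des N \<tau> = A" "Des N (inv \<tau>) = B"
      using Suc.IH by blast
    have p: "\<tau> permutes {1..N}" using \<tau> by (simp add: avoiding_231_def)
    have "insert_max N N \<tau> = \<tau>"
      using permutes_not_in[OF p] by (auto simp: insert_max_def fun_eq_iff)
    then have "\<tau> \<in> avoiding_231 (Suc N)"
      using insert_max_avoiding[OF \<tau>(1) order_refl] permutes_in_range[OF p] by simp
    moreover have "Des (Suc N) \<tau> = A" "Des (Suc N) (inv \<tau>) = B"
      using \<tau> Des_Suc_permutes[OF p] Des_Suc_permutes[OF permutes_inv[OF p]] by simp_all
    ultimately show ?thesis by blast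
  next
    case True
    obtain s where s: "s < N" "Suc s \<in> A" "s \<notin> A"
      and le: "card (A \<inter> {..s}) \<le> card (B \<inter> {..<s})"
      and above: "\<And>m. s < m \<Longrightarrow> m \<le> N \<Longrightarrow> card (B \<inter> {..<m}) < card (A \<inter> {..m})"
      using dominating_pair_obtain_split[OF d True] by metis
    \<comment> \<open>the descent sets of the permutation with its maximum deleted\<close>
    define A0 where "A0 = {i. i < s \<and> i \<in> A \<or> s < i \<and> Suc i \<in> A}"
    define B0 where "B0 = B - {N}"
    have shift: "i - 1 \<in> A0 \<longleftrightarrow> i \<in> A" if "Suc s < i" for i
    proof -
      have "s < i - 1" "Suc (i - 1) = i" using that by simp_all
      then show ?thesis unfolding A0_def by simp
    qed
    have low: "A0 \<inter> {..m} = A \<inter> {..m}" if "m \<le> s" for m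
      using that s by (auto simp: A0_def nat_less_le)
    have high: "card (A \<inter> {..Suc m}) = Suc (card (A0 \<inter> {..m}))" if "s \<le> m" for m
      using that
    proof (induction m rule: dec_induct)
      case base
      then show ?case using low[of s] s card_Int_atMost_Suc[of A s] by simp
    next
      case (step m)
      have "Suc m \<in> A0 \<longleftrightarrow> Suc (Suc m) \<in> A" using step by (auto simp: A0_def)
      then show ?case
        using step card_Int_atMost_Suc[of A "Suc m"] card_Int_atMost_Suc[of A0 m] by simp
    qed
    have A0: "A0 \<subseteq> {1..<N}" using A(1) s by (force simp: A0_def)
    have B0: "B0 \<subseteq> {1..<N}" using A(2) by (force simp: B0_def less_Suc_eq)
    have "A0 \<inter> {..N} = A0" "A \<inter> {..Suc N} = A" using A0 A(1) by force+
    then have "card A = Suc (card A0)" using high[of N] s by simp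
    moreover have "card B = Suc (card B0)" using card.remove[OF fin(2) True] by (simp add: B0_def)
    ultimately have cards: "card A0 = card B0" using A by simp
    have B0m: "B0 \<inter> {..m} = B \<inter> {..m}" if "m < N" for m using that by (auto simp: B0_def)
    have "card (B0 \<inter> {..m}) \<le> card (A0 \<inter> {..m})" for m
    proof (cases "m < N")
      case m: True
      show ?thesis
      proof (cases "m \<le> s")
        case True
        then show ?thesis using low B0m m dom by simp
      next
        case False
        then show ?thesis
          using above[of "Suc m"] high[of m] B0m[OF m] m by (simp add: lessThan_Suc_atMost)
      qed
    next
      case False
      then have "A0 \<inter> {..m} = A0" "B0 \<inter> {..m} = B0" using A0 B0 by force+
      then show ?thesis using cards by simp
    qed
    then have "(A0, B0) \<in> dominating_pairs N"
      using A0 B0 cards by (simp add: dominating_pairs_def)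
    then obtain \<tau> where \<tau>: "\<tau> \<in> avoiding_231 N" "Des N \<tau> = A0" "Des N (inv \<tau>) = B0"
      using Suc.IH by blast
    have p: "\<tau> permutes {1..N}" using \<tau> by (simp add: avoiding_231_def)
    \<comment> \<open>a crossing at \<open>s\<close> would contradict the choice of \<open>s\<close>\<close>
    have split: "\<tau> i \<le> s" if "1 \<le> i" "i \<le> s" for i
    proof (rule ccontr)
      assume "\<not> \<tau> i \<le> s"
      then have "card (B0 \<inter> {..<s}) < card (A0 \<inter> {..s})"
        using card_Des_crossing[OF \<tau>(1) _ that] \<tau> s by simp
      moreover have "B0 \<inter> {..<s} = B \<inter> {..<s}" using s by (auto simp: B0_def)
      ultimately show False using le low[of s] by simp
    qed
    define \<sigma> where "\<sigma> = insert_max N s \<tau>"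
    have av: "\<sigma> \<in> avoiding_231 (Suc N)"
      unfolding \<sigma>_def using insert_max_avoiding[OF \<tau>(1) _ split] s by simp
    have \<tau>le: "\<tau> i \<le> N" if "1 \<le> i" "i \<le> N" for i using permutes_in_range[OF p] that by blast
    have "i \<in> Des (Suc N) \<sigma> \<longleftrightarrow> i \<in> A" for i
    proof (cases "1 \<le> i \<and> i \<le> N")
      case i: True
      consider "i < s" | "i = s" | "i = Suc s" | "Suc s < i" by linarith
      then show ?thesis
      proof cases
        case 1
        then have "i \<in> Des (Suc N) \<sigma> \<longleftrightarrow> i \<in> Des N \<tau>"
          using s i by (auto simp: Des_def \<sigma>_def insert_max_def)
        then show ?thesis using 1 \<tau> by (simp add: A0_def)
      next
        case 2
        then show ?thesis using s i \<tau>le[of s] by (auto simp: Des_def \<sigma>_def insert_max_def)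
      next
        case 3
        then show ?thesis using s i \<tau>le[of "Suc s"] by (auto simp: Des_def \<sigma>_def insert_max_def)
      next
        case 4
        then have "i \<in> Des (Suc N) \<sigma> \<longleftrightarrow> i - 1 \<in> Des N \<tau>"
          using s i by (auto simp: Des_def \<sigma>_def insert_max_def)
        then show ?thesis using 4 \<tau>(2) shift by simp
      qed
    next
      case False
      then show ?thesis using A(1) by (auto simp: Des_def)
    qed
    then have D: "Des (Suc N) \<sigma> = A" by blast
    \<comment> \<open>the descents other than \<open>Suc s\<close> keep their values, so they contribute \<open>B0\<close>, and \<open>Suc s\<close>
      contributes \<open>N\<close>\<close>
    have "Des (Suc N) (inv \<sigma>) = (\<lambda>i. \<sigma> i - 1) ` A"
      using Des_inv_eq_image[OF av] D by simp
    also have "A = insert (Suc s) ((\<lambda>i. if i < s then i else Suc i) ` A0)"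
    proof (intro equalityI subsetI)
      fix a assume a: "a \<in> A"
      consider "a < s" | "a = Suc s" | "Suc s < a" using a s by (metis linorder_neqE_nat not_less_eq)
      then show "a \<in> insert (Suc s) ((\<lambda>i. if i < s then i else Suc i) ` A0)"
      proof cases
        case 1
        then have "a \<in> A0" using a by (simp add: A0_def)
        then show ?thesis using 1 by force
      next
        case 3
        then have "a - 1 \<in> A0" using a shift by simp
        then show ?thesis using 3 by (intro insertI2 image_eqI[of _ _ "a - 1"]) auto
      qed simp
    qed (use s in \<open>auto simp: A0_def\<close>)
    also have "(\<lambda>i. \<sigma> i - 1) ` \<dots> = insert N ((\<lambda>i. \<tau> i - 1) ` A0)"
    proof -
      have "\<sigma> (if i < s then i else Suc i) = \<tau> i" if "i \<in> A0" for i
        using that A0 by (auto simp: A0_def \<sigma>_def insert_max_def)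
      moreover have "\<sigma> (Suc s) = Suc N" by (simp add: \<sigma>_def insert_max_def)
      ultimately show ?thesis by (simp only: image_insert image_image cong: image_cong) simp
    qed
    also have "(\<lambda>i. \<tau> i - 1) ` A0 = B0" using Des_inv_eq_image[OF \<tau>(1)] \<tau> by simp
    also have "insert N B0 = B" using True by (auto simp: B0_def)
    finally show ?thesis using av D by blast
  qed
qed

lemma bij_betw_descent_sets:
  "bij_betw (\<lambda>\<sigma>. (Des n \<sigma>, Des n (inv \<sigma>))) (avoiding_231 n) (dominating_pairs n)"
proof (rule bij_betw_imageI[OF inj_on_descent_sets], intro equalityI subsetI)
  fix P assume "P \<in> (\<lambda>\<sigma>. (Des n \<sigma>, Des n (inv \<sigma>))) ` avoiding_231 n"
  then show "P \<in> dominating_pairs n" using descent_sets_dominating by blast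
next
  fix P assume P: "P \<in> dominating_pairs n"
  obtain A B where AB: "P = (A, B)" by (cases P)
  then obtain \<sigma> where "\<sigma> \<in> avoiding_231 n" "Des n \<sigma> = A" "Des n (inv \<sigma>) = B"
    using dominating_pair_realized P by blast
  then show "P \<in> (\<lambda>\<sigma>. (Des n \<sigma>, Des n (inv \<sigma>))) ` avoiding_231 n"
    using AB by (intro image_eqI[of _ _ \<sigma>]) simp_all
qed

section \<open>Complementation\<close>

lemma complement_dominating:
  assumes d: "(A, B) \<in> dominating_pairs n"
  shows "({1..<n} - B, {1..<n} - A) \<in> dominating_pairs n"
proof -
  have A: "A \<subseteq> {1..<n}" "B \<subseteq> {1..<n}" "card A = card B"
    and dom: "\<And>m. card (B \<inter> {..m}) \<le> card (A \<inter> {..m})"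
    using d by (auto simp: dominating_pairs_def)
  have c: "card (({1..<n} - X) \<inter> {..m}) = card ({1..<n} \<inter> {..m}) - card (X \<inter> {..m})"
    if "X \<subseteq> {1..<n}" for X m
  proof -
    have "({1..<n} - X) \<inter> {..m} = ({1..<n} \<inter> {..m}) - (X \<inter> {..m})" by auto
    then show ?thesis using that by (auto intro: card_Diff_subset)
  qed
  have "card ({1..<n} - B) = card ({1..<n} - A)"
    using A finite_subset[of _ "{1..<n}"] by (simp add: card_Diff_subset del: One_nat_def)
  moreover have "card (({1..<n} - A) \<inter> {..m}) \<le> card (({1..<n} - B) \<inter> {..m})" for m
    unfolding c[OF A(1)] c[OF A(2)] by (rule diff_le_mono2[OF dom])
  ultimately show ?thesis by (simp add: dominating_pairs_def del: One_nat_def)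
qed

lemma bij_betw_complement:
  "bij_betw (\<lambda>(A, B). ({1..<n} - B, {1..<n} - A)) (dominating_pairs n) (dominating_pairs n)"
proof -
  let ?c = "\<lambda>(A, B). ({1..<n} - B, {1..<n} - A)"
  have closed: "?c P \<in> dominating_pairs n" if "P \<in> dominating_pairs n" for P
    using that complement_dominating by (cases P) auto
  have "?c (?c P) = P" if "P \<in> dominating_pairs n" for P
    using that by (cases P) (auto simp: dominating_pairs_def)
  then show ?thesis
    using closed by (intro bij_betw_byWitness[where f' = ?c]) blast+
qed

lemma sum_complement:
  assumes "X \<subseteq> {1..<n}"
  shows "\<Sum>({1..<n} - X) = (n choose 2) - \<Sum>X"
proof -
  have "\<Sum>{1..<n} = \<Sum>{0..<n}" by (rule sum.mono_neutral_left) auto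
  then have "\<Sum>{1..<n} = n choose 2" by (simp add: Sum_Ico_nat choose_two)
  then show ?thesis using assms by (simp add: sum_diff_nat finite_subset[of X "{1..<n}"])
qed

lemma sum_le_choose_two:
  assumes "X \<subseteq> {1..<n}"
  shows "\<Sum>X \<le> n choose 2"
proof -
  have "\<Sum>X \<le> \<Sum>{0..<n}" using assms by (intro sum_mono2) auto
  then show ?thesis by (simp add: Sum_Ico_nat choose_two)
qed

lemma A_poly_eq_sum_dominating_pairs:
  "A_poly n q t = (\<Sum>(A, B)\<in>dominating_pairs n. q ^ \<Sum>A * t ^ ((n choose 2) - \<Sum>B))"
  using sum.reindex_bij_betw[OF bij_betw_descent_sets[of n],
      of "\<lambda>(A, B). q ^ \<Sum>A * t ^ ((n choose 2) - \<Sum>B)"]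
  by (simp add: A_poly_def imaj_def maj_def)

theorem corollary4p3:
  fixes n :: nat and q t :: "'a::comm_semiring_1"
  assumes "n \<ge> 1"
  shows "A_poly n q t = A_poly n t q"
proof -
  let ?w = "\<lambda>q t (A, B). q ^ \<Sum>A * t ^ ((n choose 2) - \<Sum>B) :: 'a"
  let ?c = "\<lambda>(A, B). ({1..<n} - B, {1..<n} - A)"
  have "A_poly n q t = (\<Sum>P\<in>dominating_pairs n. ?w q t P)"
    by (simp add: A_poly_eq_sum_dominating_pairs)
  also have "\<dots> = (\<Sum>P\<in>dominating_pairs n. ?w q t (?c P))"
    by (rule sum.reindex_bij_betw[OF bij_betw_complement, symmetric])
  also have "\<dots> = (\<Sum>P\<in>dominating_pairs n. ?w t q P)"
  proof (rule sum.cong[OF refl])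
    fix P assume "P \<in> dominating_pairs n"
    then obtain A B where P: "P = (A, B)" "A \<subseteq> {1..<n}" "B \<subseteq> {1..<n}"
      by (auto simp: dominating_pairs_def)
    have "(n choose 2) - \<Sum>({1..<n} - A) = \<Sum>A"
      using sum_complement[OF P(2)] sum_le_choose_two[OF P(2)] by simp
    then show "?w q t (?c P) = ?w t q P"
      using P sum_complement[OF P(3)] by (simp add: mult.commute)
  qed
  also have "\<dots> = A_poly n t q"
    by (simp add: A_poly_eq_sum_dominating_pairs)
  finally show ?thesis .
qed

end
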